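(* Let $k \geq 2$ be a natural number and let $G$ be a finite graph of average degree at least $6k$ and girth $g$. Then, for some odd number $r \geq 3$, either $G$ contains cycles of all even lengths in the interval $[r, r + (g-2)k]$, or $G$ contains cycles of all odd lengths in the interval $[r, r+(g-2)k]$.
   Context: The average degree of a graph $G$ is $2|E(G)|/|V(G)|$. The girth of $G$ is the length of a shortest cycle in $G$. *)

theory Defs
  imports Complex_Main "HOL-Library.Extended_Nat"
begin

text \<open>Graphs are simple: a vertex set \<open>V\<close> together with a set \<open>E\<close> of two-element subsets of \<open>V\<close>.\<close>

definition finite_graph :: "'a set \<Rightarrow> 'a set set \<Rightarrow> bool" where
  "finite_graph V E \<longleftrightarrow> finite V \<and> (\<forall>e\<in>E. e \<subseteq> V \<and> card e = 2)"

definition average_degree :: "'a set \<Rightarrow> 'a set set \<Rightarrow> real" where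
  "average_degree V E = 2 * real (card E) / real (card V)"

text \<open>A cycle is given by the cyclic list of its vertices; its length, the number of its edges,
  is the length of the list.\<close>

definition is_cycle :: "'a set set \<Rightarrow> 'a list \<Rightarrow> bool" where
  "is_cycle E xs \<longleftrightarrow> length xs \<ge> 3 \<and> distinct xs \<and>
     (\<forall>i<length xs. {xs ! i, xs ! (Suc i mod length xs)} \<in> E)"

definition has_cycle_of_length :: "'a set set \<Rightarrow> nat \<Rightarrow> bool" where
  "has_cycle_of_length E n \<longleftrightarrow> (\<exists>xs. is_cycle E xs \<and> length xs = n)"

text \<open>The girth of an acyclic graph is \<open>\<infinity>\<close>; otherwise it is at least 3.\<close>

definition girth :: "'a set set \<Rightarrow> enat" where
  "girth E = Inf {enat n | n. has_cycle_of_length E n}"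

end

theory Submission
  imports Defs
begin

text \<open>
  Following Verstraete, the idea is to find a cycle with a chord inside one level, or between two
  consecutive levels, of a breadth-first search tree of a component, and to close up paths of many
  lengths in it through the tree.  A component has at least \<open>3k\<close> times as many edges as vertices, so
  some level, or some pair of consecutive levels, has at least \<open>k\<close> times as many edges as vertices and
  thus contains a subgraph of minimum degree at least \<open>k + 1\<close>.  The neighbours of the first vertex of
  a longest path there are spaced by at least \<open>g - 2\<close>, which gives a cycle with a chord on
  at least \<open>(g - 2)k + 2\<close> vertices.  The deepest common ancestor of its vertices on level \<open>i\<close> splits
  them into a class \<open>A\<close> and its complement such that any two vertices from different classes are
  joined by a tree path of the same length \<open>2j\<close>.  A cycle with a chord contains paths of all lengths
  with exactly one end in \<open>A\<close>, unless \<open>A\<close> alternates around the cycle; in that exceptional case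
  the odd lengths still occur, and it cannot arise between two levels.
\<close>

section \<open>Paths and cycles with a chord\<close>

text \<open>A path is the list of its vertices, so a path of length \<open>t\<close> has
  \<open>t + 1\<close> entries. The empty list is allowed, which spares side conditions when paths
  are cut.\<close>

definition is_path :: "'a set set \<Rightarrow> 'a list \<Rightarrow> bool" where
  "is_path E xs \<longleftrightarrow> distinct xs \<and> successively (\<lambda>x y. {x, y} \<in> E) xs"

lemma is_path_rev [simp]: "is_path E (rev xs) \<longleftrightarrow> is_path E xs"
  by (simp add: is_path_def insert_commute)

lemma is_path_append:
  assumes "is_path E xs" "is_path E ys" "set xs \<inter> set ys = {}"
    and "xs \<noteq> [] \<Longrightarrow> ys \<noteq> [] \<Longrightarrow> {last xs, hd ys} \<in> E"
  shows "is_path E (xs @ ys)"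
  using assms by (auto simp: is_path_def successively_append_iff)

lemma is_path_appendD:
  assumes "is_path E (xs @ ys)"
  shows "is_path E xs" "is_path E ys"
  using assms by (auto simp: is_path_def successively_append_iff)

lemma is_path_take: "is_path E xs \<Longrightarrow> is_path E (take n xs)"
  by (rule is_path_appendD(1)[of E "take n xs" "drop n xs"]) simp

lemma is_path_drop: "is_path E xs \<Longrightarrow> is_path E (drop n xs)"
  by (rule is_path_appendD(2)[of E "take n xs" "drop n xs"]) simp

lemma is_path_mono: "is_path E xs \<Longrightarrow> E \<subseteq> E' \<Longrightarrow> is_path E' xs"
  unfolding is_path_def by (auto elim: successively_mono)

lemma is_cycle_of_path:
  assumes "is_path E xs" "length xs \<ge> 3" "{last xs, hd xs} \<in> E"
  shows "is_cycle E xs"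
  unfolding is_cycle_def
proof (intro conjI allI impI)
  fix i assume i: "i < length xs"
  show "{xs ! i, xs ! (Suc i mod length xs)} \<in> E"
  proof (cases "Suc i = length xs")
    case True
    then have "xs \<noteq> []" "i = length xs - 1" by auto
    then have "xs ! i = last xs" "xs ! 0 = hd xs"
      by (simp_all add: last_conv_nth hd_conv_nth)
    then show ?thesis using assms(3) True by simp
  next
    case False
    then show ?thesis
      using assms(1) i by (simp add: is_path_def successively_conv_nth)
  qed
qed (use assms in \<open>auto simp: is_path_def\<close>)

text \<open>Removing the maximum repeatedly shows that at least \<open>k\<close> gaps, each at least
  \<open>D\<close>, separate the minimum from the maximum.\<close>

lemma Max_ge_spread:
  fixes I :: "nat set"
  assumes "finite I" "card I \<ge> Suc k" "\<And>i j. i \<in> I \<Longrightarrow> j \<in> I \<Longrightarrow> i < j \<Longrightarrow> i + D \<le> j"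
  shows "Min I + D * k \<le> Max I"
  using assms
proof (induction k arbitrary: I)
  case 0
  then have "I \<noteq> {}" by auto
  with 0 show ?case by simp
next
  case (Suc k)
  let ?J = "I - {Max I}"
  have ne: "I \<noteq> {}" using Suc.prems by auto
  then have mem: "Max I \<in> I" using Suc.prems by simp
  have cJ: "card ?J \<ge> Suc k" using Suc.prems mem by simp
  then have neJ: "?J \<noteq> {}" by (metis card.empty not_less_eq_eq zero_le)
  have fJ: "finite ?J" using Suc.prems by simp
  have IH: "Min ?J + D * k \<le> Max ?J"
    by (rule Suc.IH[OF fJ cJ]) (use Suc.prems in auto)
  have mJ: "Max ?J \<in> ?J" by (rule Max_in[OF fJ neJ])
  then have lt: "Max ?J < Max I" using Max_ge[OF Suc.prems(1), of "Max ?J"] by auto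
  have "Max ?J + D \<le> Max I" using Suc.prems(3)[OF _ mem lt] mJ by blast
  moreover have "Min I \<le> Min ?J" using fJ neJ Suc.prems(1) by (intro Min_antimono) auto
  ultimately show ?case using IH by simp
qed

lemma long_cycle_with_chord:
  assumes fin: "finite U" and ne: "U \<noteq> {}" and k: "k \<ge> 2"
    and deg: "\<And>v. v \<in> U \<Longrightarrow> Suc k \<le> card {u \<in> U. {v, u} \<in> F}"
    and loopless: "\<And>v. {v, v} \<notin> F"
    and girth: "\<And>m. has_cycle_of_length F m \<Longrightarrow> g \<le> m"
  obtains xs r where "is_path F xs" "set xs \<subseteq> U" "(g - 2) * k + 2 \<le> length xs"
    "{hd xs, last xs} \<in> F" "{hd xs, xs ! r} \<in> F" "2 \<le> r" "r + 2 \<le> length xs"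
proof -
  let ?P = "\<lambda>xs. is_path F xs \<and> set xs \<subseteq> U \<and> xs \<noteq> []"
  obtain u where "u \<in> U" using ne by blast
  then have "?P [u]" by (simp add: is_path_def)
  moreover have "\<And>ys. ?P ys \<Longrightarrow> length ys < Suc (card U)"
    by (metis card_mono distinct_card fin is_path_def le_imp_less_Suc)
  ultimately obtain xs where xs: "?P xs" and mx: "\<And>ys. ?P ys \<Longrightarrow> length ys \<le> length xs"
    using ex_has_greatest_nat[of ?P "[u]" length "Suc (card U)"] by blast
  define v where "v = hd xs"
  have v: "v \<in> U" "xs ! 0 = v" using xs by (auto simp: v_def hd_conv_nth)
  define I where "I = {i. i < length xs \<and> {v, xs ! i} \<in> F}"
  have finI: "finite I" by (simp add: I_def)
  \<comment> \<open>A neighbour of \<open>v\<close> in \<open>U\<close> outside the path could be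
    put in front of it, against maximality.\<close>
  have nbr: "{u \<in> U. {v, u} \<in> F} \<subseteq> (!) xs ` I"
  proof
    fix u assume u: "u \<in> {u \<in> U. {v, u} \<in> F}"
    have "u \<in> set xs"
    proof (rule ccontr)
      assume "u \<notin> set xs"
      then have "?P (u # xs)" using xs u
        by (cases xs) (auto simp: is_path_def v_def insert_commute)
      from mx[OF this] show False by simp
    qed
    with u show "u \<in> (!) xs ` I" by (auto simp: in_set_conv_nth I_def)
  qed
  have cI: "card I \<ge> Suc k"
    using deg[OF v(1)] card_mono[OF _ nbr] card_image_le[OF finI, of "(!) xs"] finI by fastforce
  have pos: "i \<ge> 1" if "i \<in> I" for i
    using that loopless v(2) by (cases i) (auto simp: I_def)
  have gap: "i + (g - 2) \<le> j" if ij: "i \<in> I" "j \<in> I" "i < j" for i j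
  proof -
    \<comment> \<open>The segment from position \<open>i\<close> to position \<open>j\<close>,
      closed up through \<open>v\<close>, is a cycle of length \<open>j - i + 2\<close>.\<close>
    define ys where "ys = drop i (take (Suc j) xs)"
    have jl: "j < length xs" using ij by (simp add: I_def)
    have len: "length ys = Suc j - i" using jl by (simp add: ys_def)
    have yne: "ys \<noteq> []" using len ij by auto
    have hy: "hd ys = xs ! i" using ij jl by (simp add: ys_def hd_drop_conv_nth)
    have ly: "last ys = xs ! j" using ij jl yne len by (simp add: last_conv_nth) (simp add: ys_def)
    have "set ys \<subseteq> set (drop 1 xs)"
      using pos[OF ij(1)] by (metis ys_def drop_take set_drop_subset_set_drop set_take_subset subset_trans)
    moreover have "v \<notin> set (drop 1 xs)"
      using xs by (cases xs) (auto simp: v_def is_path_def)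
    ultimately have vn: "v \<notin> set ys" by blast
    have "is_path F ys" unfolding ys_def using xs by (blast intro: is_path_drop is_path_take)
    then have "is_path F (v # ys)"
      using is_path_append[of F "[v]" ys] vn ij hy by (auto simp: is_path_def I_def)
    moreover have "{last (v # ys), hd (v # ys)} \<in> F" using yne ly ij by (auto simp: I_def insert_commute)
    ultimately have "is_cycle F (v # ys)"
      using len ij by (intro is_cycle_of_path) auto
    then have "g \<le> length (v # ys)" using girth has_cycle_of_length_def by blast
    then show ?thesis using len ij by simp
  qed
  define M where "M = Max I"
  have neI: "I \<noteq> {}" using cI by auto
  have M: "M \<in> I" unfolding M_def using finI neI by simp
  have "Min I \<in> I" using finI neI by simp
  then have large: "(g - 2) * k + 1 \<le> M"
    using Max_ge_spread[OF finI cI gap] pos[of "Min I"] by (simp add: M_def)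
  \<comment> \<open>As \<open>k \<ge> 2\<close>, \<open>I\<close> has at least three elements. One
    other than 1 and \<open>M\<close> provides the chord; position \<open>M\<close>, where the path
    is cut off, provides the closing edge.\<close>
  have "\<not> I \<subseteq> {1, M}"
  proof
    assume "I \<subseteq> {1, M}"
    from card_mono[OF _ this] have "card I \<le> 2" by (auto simp: card_insert_if split: if_splits)
    with cI k show False by simp
  qed
  then obtain r where r: "r \<in> I" "r \<noteq> 1" "r \<noteq> M" by blast
  have rM: "r < M" using r finI by (metis M_def Max_ge le_neq_implies_less)
  have Ml: "M < length xs" using M by (simp add: I_def)
  let ?ys = "take (Suc M) xs"
  have len: "length ?ys = Suc M" using Ml by simp
  have "hd ?ys = v" using xs by (simp add: v_def)
  moreover have "last ?ys = xs ! M" using Ml xs by (subst last_conv_nth) auto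
  moreover have "?ys ! r = xs ! r" using rM by simp
  moreover have "set ?ys \<subseteq> U" using xs set_take_subset by fast
  ultimately have "is_path F ?ys \<and> set ?ys \<subseteq> U \<and> (g - 2) * k + 2 \<le> length ?ys \<and>
    {hd ?ys, last ?ys} \<in> F \<and> {hd ?ys, ?ys ! r} \<in> F \<and> 2 \<le> r \<and> r + 2 \<le> length ?ys"
    unfolding len
    using xs is_path_take[of F xs] large M r rM pos[OF r(1)] by (auto simp: I_def)
  then show ?thesis using that by blast
qed

section \<open>Paths of prescribed length in a cycle with a chord\<close>

definition period :: "(int \<Rightarrow> bool) \<Rightarrow> int \<Rightarrow> bool" where
  "period h p \<longleftrightarrow> (\<forall>i. h (i + p) = h i)"

lemma period_add: "period h p \<Longrightarrow> period h q \<Longrightarrow> period h (p + q)"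
  by (simp add: period_def flip: add.assoc)

lemma period_minus: "period h p \<Longrightarrow> period h (- p)"
  unfolding period_def by (metis add.right_inverse add.assoc add.right_neutral add.commute)

lemma period_mult: "period h p \<Longrightarrow> period h (m * p)"
proof (induction m rule: int_induct[of _ 0])
  case base
  then show ?case by (simp add: period_def)
next
  case (step1 i)
  then show ?case using period_add[of h "i * p" p] by (simp add: algebra_simps)
next
  case (step2 i)
  then show ?case using period_add[of h "i * p" "- p"] period_minus by (simp add: algebra_simps)
qed

lemma period_gcd: "period h p \<Longrightarrow> period h q \<Longrightarrow> period h (gcd p q)"
  by (metis bezout_int period_add period_mult)

lemma period_reflect: "period h p \<Longrightarrow> period (\<lambda>j. h (c - j)) p"
  using period_minus[of h p] unfolding period_def by (metis diff_diff_eq uminus_add_conv_diff add.commute diff_conv_add_uminus)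

lemma period_shift: "period h p \<Longrightarrow> period (\<lambda>j. h (c + j)) p"
  unfolding period_def by (metis add.assoc)

lemma period_mod: "period h p \<Longrightarrow> h (i mod p) = h i"
  using period_mult[of h p "i div p"] unfolding period_def by (metis mod_mult_div_eq add.commute mult.commute)

text \<open>Every integer is congruent modulo \<open>p\<close> to one in the window of
  \<open>p\<close> consecutive integers starting at \<open>c\<close>.\<close>

lemma period_eqI:
  assumes "period h p" "period q p" "p > 0" "\<And>j. c \<le> j \<Longrightarrow> j < c + p \<Longrightarrow> h j = q j"
  shows "h i = q i"
proof -
  let ?j = "c + (i - c) mod p"
  have i: "i = ?j + ((i - c) div p) * p" by (simp add: algebra_simps minus_mod_eq_mult_div)
  have "h i = h ?j" "q i = q ?j"
    using period_mult[OF assms(1), of "(i - c) div p"] period_mult[OF assms(2), of "(i - c) div p"]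
    unfolding period_def by (metis i)+
  then show ?thesis using assms(3,4) by simp
qed

lemma periodic_window_inj:
  fixes i j n :: int
  assumes "i mod n = j mod n" "i < j + n" "j < i + n"
  shows "i = j"
proof -
  have "n dvd i - j" using assms(1) by (simp add: mod_eq_dvd_iff)
  then show ?thesis using assms(2,3) zdvd_imp_le[of n "i - j"] zdvd_imp_le[of n "j - i"]
    by (smt (verit) dvd_minus_iff minus_diff_eq)
qed

lemma is_path_arc:
  fixes f :: "int \<Rightarrow> 'a"
  assumes "\<And>i j. f i = f j \<longleftrightarrow> i mod n = j mod n" "\<And>i. {f i, f (i + 1)} \<in> F" "b < a + n"
  shows "is_path F (map f [a..b])"
proof -
  have "inj_on f {a..b}"
    by (rule inj_onI, rule periodic_window_inj[of _ n]) (use assms(1,3) in auto)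
  then show ?thesis
    unfolding is_path_def successively_conv_nth distinct_map
    using assms(2)[of "a + int i" for i] by (auto simp: ac_simps)
qed

text \<open>The cycle is given by its \<open>n\<close>-periodic enumeration by the integers.\<close>

lemma chorded_cycle_paths:
  fixes f :: "int \<Rightarrow> 'a" and n r t :: int
  assumes f_eq: "\<And>i j. f i = f j \<longleftrightarrow> i mod n = j mod n"
    and edge: "\<And>i. {f i, f (i + 1)} \<in> F" and chord: "{f 0, f r} \<in> F"
    and r: "2 \<le> r" "r + 2 \<le> n" and t: "0 < t" "t < n"
    and no_path: "\<And>p. is_path F p \<Longrightarrow> set p \<subseteq> range f \<Longrightarrow> int (length p) = t + 1 \<Longrightarrow> P (hd p) = P (last p)"
  shows "period (\<lambda>i. P (f i)) 2"
proof -
  define h where "h = (\<lambda>i. P (f i))"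
  have inj: "i = j" if "f i = f j" "i < j + n" "j < i + n" for i j
    using that f_eq periodic_window_inj by blast
  note arc = is_path_arc[of f n, OF f_eq edge]
  have pn: "period h n" unfolding period_def h_def using f_eq[of "i + n" i for i] by auto
  have hd_upto: "hd [a..b] = a" if "a \<le> b" for a b :: int
    using that by (simp add: hd_conv_nth)
  have last_upto: "last [a..b] = b" if "a \<le> b" for a b :: int
    using that by (simp add: last_conv_nth)
  note ends = hd_upto last_upto hd_map last_map hd_rev last_rev hd_append last_append
  \<comment> \<open>The arc from \<open>f i\<close> to \<open>f (i + t)\<close> is itself a path of
    length \<open>t\<close>, so its ends agree.\<close>
  have pt: "period h t"
    unfolding period_def
  proof
    fix i
    have "P (hd (map f [i..i + t])) = P (last (map f [i..i + t]))"
      using t by (intro no_path arc) auto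
    then show "h (i + t) = h i" using t by (simp add: h_def ends)
  qed
  \<comment> \<open>This common period divides both \<open>t\<close> and \<open>n - t\<close>, hence
    is at most either of them; these bounds make a full window of length \<open>d\<close> fit into
    the restricted ranges of \<open>j\<close> below.\<close>
  define d where "d = gcd n t"
  have pd: "period h d" unfolding d_def using period_gcd pn pt by blast
  have d0: "d > 0" using t by (simp add: d_def)
  have "d dvd n - t" by (simp add: d_def)
  then have dt: "d \<le> n - t" using t by (intro zdvd_imp_le) auto
  have "d dvd t" by (simp add: d_def)
  then have dt': "d \<le> t" using t by (intro zdvd_imp_le) auto
  \<comment> \<open>The lists \<open>p\<close> and \<open>q\<close> hold positions: the path follows
    the cycle to 0, crosses the chord and goes on from \<open>r\<close>. The last premise ensures
    that \<open>p\<close> and \<open>q\<close> share no vertex modulo \<open>n\<close>.\<close>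
  have glue: "h (hd p) = h (last q)"
    if "is_path F (map f p)" "is_path F (map f q)" "p \<noteq> []" "q \<noteq> []"
      "last p = 0" "hd q = r" "int (length p + length q) = t + 1"
      "\<And>i j. i \<in> set p \<Longrightarrow> j \<in> set q \<Longrightarrow> i < j + n \<and> j < i + n \<and> i \<noteq> j" for p q
  proof -
    have "f i \<noteq> f j" if "i \<in> set p" "j \<in> set q" for i j
      using inj[of i j] that(1,2) \<open>\<And>i j. i \<in> set p \<Longrightarrow> j \<in> set q \<Longrightarrow> i < j + n \<and> j < i + n \<and> i \<noteq> j\<close>[of i j]
      by blast
    then have "is_path F (map f p @ map f q)"
      using that(1-6) chord by (intro is_path_append) (auto simp: ends)
    then have "P (hd (map f p @ map f q)) = P (last (map f p @ map f q))"
      using that(7) by (intro no_path) auto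
    then show ?thesis using that(3,4) by (simp add: h_def ends)
  qed
  have rarc: "is_path F (map f (rev [a..b]))" if "b < a + n" for a b
    using arc[OF that] by (simp add: rev_map[symmetric])
  \<comment> \<open>The four ways in which a path of length \<open>t\<close> can traverse the chord from \<open>0\<close> to \<open>r\<close>.\<close>
  have X: "h (- j) = h (r + t - 1 - j)" if "0 \<le> j" "j < t" "t \<le> n - r" for j
    using glue[of "[- j..0]" "[r..r + t - 1 - j]", OF arc arc] that r t by (simp add: ends)
  have X': "h j = h (r - t + 1 + j)" if "0 \<le> j" "j < t" "t \<le> r" for j
    using glue[of "rev [0..j]" "rev [r - t + 1 + j..r]", OF rarc rarc] that r t by (simp add: ends)
  have Y: "h (- j) = h (r - t + 1 + j)" if "0 \<le> j" "t - r \<le> j" "j < n - r" "j < t" for j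
    using glue[of "[- j..0]" "rev [r - t + 1 + j..r]", OF arc rarc] that r t by (simp add: ends)
  have Y': "h j = h (r + t - 1 - j)" if "0 \<le> j" "t - (n - r) \<le> j" "j < r" "j < t" for j
    using glue[of "rev [0..j]" "[r..r + t - 1 - j]", OF rarc arc] that r t by (simp add: ends)
  \<comment> \<open>Removing the period \<open>t\<close> turns \<open>X\<close> and
    \<open>X'\<close> into shifts by \<open>r - 1\<close> and \<open>r + 1\<close>, and
    \<open>Y\<close> and \<open>Y'\<close> into reflections.\<close>
  have ht: "h (i + t) = h i" "h (i - t) = h i" for i
    using pt period_minus[OF pt] by (simp_all add: period_def)
  have X1: "h (- j) = h ((r - 1) - j)" if "0 \<le> j" "j < t" "t \<le> n - r" for j
    using X[OF that] ht(1)[of "r - 1 - j"] by (simp add: algebra_simps)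
  have X1': "h j = h (r + 1 + j)" if "0 \<le> j" "j < t" "t \<le> r" for j
    using X'[OF that] ht(2)[of "r + 1 + j"] by (simp add: algebra_simps)
  have Y1: "h (- j) = h (r + 1 + j)" if "0 \<le> j" "t - r \<le> j" "j < n - r" "j < t" for j
    using Y[OF that] ht(2)[of "r + 1 + j"] by (simp add: algebra_simps)
  have Y1': "h j = h (r - 1 - j)" if "0 \<le> j" "t - (n - r) \<le> j" "j < r" "j < t" for j
    using Y'[OF that] ht(1)[of "r - 1 - j"] by (simp add: algebra_simps)
  \<comment> \<open>The shift is known only for \<open>t\<close> consecutive values of
    \<open>j\<close>, but \<open>d \<le> t\<close>, so these cover a window of the period
    \<open>d\<close>.\<close>
  have pX: "period h (r - 1)" if "t \<le> n - r"
  proof -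
    have "h (0 - j) = h (r - 1 - j)" for j
      by (rule period_eqI[of _ d _ 0, OF period_reflect[OF pd] period_reflect[OF pd] d0])
        (use X1 that dt' in auto)
    then have "h (r - 1 - (- i)) = h (0 - (- i))" for i by blast
    then show ?thesis by (simp add: period_def algebra_simps)
  qed
  have pX': "period h (r + 1)" if "t \<le> r"
  proof -
    have "h j = h (r + 1 + j)" for j
      by (rule period_eqI[of _ d _ 0, OF pd period_shift[OF pd] d0])
        (use X1' that dt' in auto)
    then show ?thesis by (simp add: period_def algebra_simps)
  qed
  \<comment> \<open>\<open>Y1\<close> and \<open>Y1'\<close> say that \<open>h\<close> is symmetric under two reflections whose centres differ by 1; a window
    of \<open>p\<close> consecutive instances of each suffices when \<open>h\<close> has period \<open>p\<close>.\<close>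
  have period_2_by_reflections: "period h 2"
    if p: "period h p" "p > 0" and Yp: "max 0 (t - r) + p \<le> min t (n - r)"
      and Yp': "max 0 (t - (n - r)) + p \<le> min t r" for p
  proof -
    have "h (0 - j) = h (r + 1 + j)" for j
      by (rule period_eqI[of _ p _ "max 0 (t - r)", OF period_reflect[OF p(1)] period_shift[OF p(1)] p(2)])
        (use Y1 Yp in auto)
    moreover have "h j = h (r - 1 - j)" for j
      by (rule period_eqI[of _ p _ "max 0 (t - (n - r))", OF p(1) period_reflect[OF p(1)] p(2)])
        (use Y1' Yp' in auto)
    ultimately have "h (r - 1 - (- j)) = h (r + 1 + j)" for j
      by (metis diff_0)
    then have "h (r - 1 - (- (i + 1 - r))) = h (r + 1 + (i + 1 - r))" for i by blast
    then show ?thesis by (simp add: period_def algebra_simps)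
  qed
  have "period h 2"
  \<comment> \<open>The chord cuts the cycle into arcs of lengths \<open>r\<close> and
    \<open>n - r\<close>. If \<open>t\<close> exceeds neither, the periods \<open>r + 1\<close> and
    \<open>r - 1\<close> differ by 2. If it exceeds just one, the period \<open>r - 1\<close> or
    \<open>n - r - 1\<close> is short enough for the reflections; if it exceeds both,
    \<open>d \<le> n - t\<close> is.\<close>
  proof (cases "t \<le> n - r"; cases "t \<le> r")
    assume "t \<le> n - r" "t \<le> r"
    then show ?thesis using period_add[OF pX' period_minus[OF pX]] by simp
  next
    assume "t \<le> n - r" "\<not> t \<le> r"
    then show ?thesis using period_2_by_reflections[OF pX] r by simp
  next
    assume *: "\<not> t \<le> n - r" "t \<le> r"
    have "period h (n - r - 1)"
      using period_add[OF pn period_minus[OF pX'[OF *(2)]]] by (simp add: algebra_simps)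
    then show ?thesis using period_2_by_reflections[of "n - r - 1"] * r t by simp
  next
    assume "\<not> t \<le> n - r" "\<not> t \<le> r"
    then show ?thesis using period_2_by_reflections[OF pd d0] dt by simp
  qed
  then show ?thesis by (simp add: h_def)
qed


section \<open>Dense subgraphs and breadth-first levels\<close>

abbreviation edges_in :: "'a set set \<Rightarrow> 'a set \<Rightarrow> 'a set set" where
  "edges_in F U \<equiv> {e \<in> F. e \<subseteq> U}"

lemma finite_edges_in: "finite U \<Longrightarrow> finite (edges_in F U)"
  by (rule finite_subset[of _ "Pow U"]) auto

lemma card_le_add:
  assumes "finite X" "finite Y" "Z \<subseteq> X \<union> Y"
  shows "card Z \<le> card X + card Y"
  using card_mono[OF _ assms(3)] card_Un_le[of X Y] assms(1,2) by simp

text \<open>Minimality serves twice: it forces large degrees in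
  \<open>dense_subset_min_degree\<close> and connectedness in
  \<open>minimal_dense_connected\<close>.\<close>

lemma minimal_dense_subset:
  assumes "U \<noteq> {}" "K * card U \<le> card (edges_in F U)" "finite U"
  obtains W where "W \<subseteq> U" "W \<noteq> {}" "K * card W \<le> card (edges_in F W)"
    "\<And>W'. W' \<subset> W \<Longrightarrow> W' \<noteq> {} \<Longrightarrow> card (edges_in F W') < K * card W'"
proof -
  let ?P = "\<lambda>W. W \<subseteq> U \<and> W \<noteq> {} \<and> K * card W \<le> card (edges_in F W)"
  obtain W where W: "?P W" and least: "\<And>W'. ?P W' \<Longrightarrow> card W \<le> card W'"
    using ex_has_least_nat[of ?P U card] assms(1,2) by blast
  have "card (edges_in F W') < K * card W'" if "W' \<subset> W" "W' \<noteq> {}" for W'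
  proof -
    have "card W' < card W" using that W assms(3) by (meson finite_subset psubset_card_mono)
    then have "\<not> ?P W'" using least[of W'] by linarith
    then show ?thesis using that W by auto
  qed
  with that W show ?thesis by blast
qed

text \<open>Deleting \<open>v\<close> from a minimal dense \<open>W\<close> leaves fewer than
  \<open>K * (card W - 1)\<close> edges, so more than \<open>K\<close> edges meet
  \<open>v\<close>.\<close>

lemma dense_subset_min_degree:
  assumes fin: "finite U" and ne: "U \<noteq> {}" and dense: "K * card U \<le> card (edges_in F U)"
    and K: "K \<ge> 1" and simple: "\<And>e. e \<in> F \<Longrightarrow> card e = 2"
  obtains W where "W \<subseteq> U" "W \<noteq> {}" "\<And>v. v \<in> W \<Longrightarrow> Suc K \<le> card {u \<in> W. {v, u} \<in> F}"
proof -
  obtain W where W: "W \<subseteq> U" "W \<noteq> {}" "K * card W \<le> card (edges_in F W)"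
    and minimal: "\<And>W'. W' \<subset> W \<Longrightarrow> W' \<noteq> {} \<Longrightarrow> card (edges_in F W') < K * card W'"
    using minimal_dense_subset[OF ne dense fin] by blast
  have finW: "finite W" using W(1) fin finite_subset by blast
  have "Suc K \<le> card {u \<in> W. {v, u} \<in> F}" if v: "v \<in> W" for v
  proof -
    let ?N = "{u \<in> W. {v, u} \<in> F}" and ?W' = "W - {v}"
    have "edges_in F W \<subseteq> edges_in F ?W' \<union> (\<lambda>u. {v, u}) ` ?N"
    proof
      fix e assume e: "e \<in> edges_in F W"
      show "e \<in> edges_in F ?W' \<union> (\<lambda>u. {v, u}) ` ?N"
      proof (cases "v \<in> e")
        case True
        obtain u where "e = {v, u}"
          using simple[of e] e True by (auto simp: card_2_iff)
        with e show ?thesis by auto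
      qed (use e in auto)
    qed
    then have "card (edges_in F W) \<le> card (edges_in F ?W') + card ((\<lambda>u. {v, u}) ` ?N)"
      using finW by (intro card_le_add finite_edges_in) auto
    also have "\<dots> \<le> card (edges_in F ?W') + card ?N"
      using finW by (intro add_mono card_image_le) auto
    finally have "card (edges_in F W) \<le> card (edges_in F ?W') + card ?N" .
    moreover have "K * card W = K * card ?W' + K"
      unfolding card.remove[OF finW v] by simp
    ultimately have deg: "K * card ?W' + K \<le> card (edges_in F ?W') + card ?N" using W(3) by linarith
    show ?thesis
    \<comment> \<open>Minimality says nothing about the empty set; but a single vertex spans no
      edge, which contradicts density as \<open>K \<ge> 1\<close>.\<close>
    proof (cases "?W' = {}")
      case True
      then have "W = {v}" using v by blast
      then have "?N = {}" "edges_in F ?W' = {}"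
        using simple[of "{v, v}"] simple[of "{}"] by auto
      with deg K show ?thesis by (simp only: card.empty)
    next
      case False
      then have "card (edges_in F ?W') < K * card ?W'" using minimal v by blast
      with deg show ?thesis by linarith
    qed
  qed
  with that W show ?thesis by blast
qed

text \<open>Otherwise no edge joins the vertices reachable from \<open>a\<close> to the rest of
  \<open>W\<close>. Both parts are sparse by minimality, and adding up their edges contradicts the
  density of \<open>W\<close>.\<close>

lemma minimal_dense_connected:
  assumes fin: "finite W" and a: "a \<in> W" and dense: "K * card W \<le> card (edges_in F W)"
    and minimal: "\<And>W'. W' \<subset> W \<Longrightarrow> W' \<noteq> {} \<Longrightarrow> card (edges_in F W') < K * card W'"
    and simple: "\<And>e. e \<in> F \<Longrightarrow> card e = 2" and x: "x \<in> W"
  shows "(a, x) \<in> {(x, y). x \<in> W \<and> y \<in> W \<and> {x, y} \<in> F}\<^sup>*"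
proof (rule ccontr)
  let ?R = "{(x, y). x \<in> W \<and> y \<in> W \<and> {x, y} \<in> F}"
  assume nx: "(a, x) \<notin> ?R\<^sup>*"
  define W1 where "W1 = {y \<in> W. (a, y) \<in> ?R\<^sup>*}"
  have "a \<in> W1" "x \<in> W - W1" using a x nx by (auto simp: W1_def)
  moreover have "W1 \<subseteq> W" by (auto simp: W1_def)
  ultimately have lt: "card (edges_in F W1) < K * card W1" "card (edges_in F (W - W1)) < K * card (W - W1)"
    by (intro minimal; blast)+
  have "edges_in F W \<subseteq> edges_in F W1 \<union> edges_in F (W - W1)"
  proof
    fix e assume e: "e \<in> edges_in F W"
    then obtain u v where uv: "e = {u, v}" using simple[of e] by (auto simp: card_2_iff)
    then have "(u, v) \<in> ?R" "(v, u) \<in> ?R" using e by (auto simp: insert_commute)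
    then have "u \<in> W1 \<longleftrightarrow> v \<in> W1"
      unfolding W1_def by (auto intro: rtrancl_into_rtrancl)
    then show "e \<in> edges_in F W1 \<union> edges_in F (W - W1)" using e uv by auto
  qed
  then have "card (edges_in F W) \<le> card (edges_in F W1) + card (edges_in F (W - W1))"
    using fin \<open>W1 \<subseteq> W\<close> by (intro card_le_add finite_edges_in) (auto intro: finite_subset)
  moreover have "K * card W = K * card W1 + K * card (W - W1)"
    using card_Diff_subset[of W1 W] card_mono[OF fin \<open>W1 \<subseteq> W\<close>] finite_subset[OF \<open>W1 \<subseteq> W\<close> fin] \<open>W1 \<subseteq> W\<close>
    by (simp flip: add_mult_distrib2)
  ultimately show False using lt dense by linarith
qed

text \<open>Here \<open>d\<close> is the distance from \<open>a\<close> within \<open>W\<close>, and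
  \<open>p\<close> picks for each vertex other than the root a neighbour one step closer to
  \<open>a\<close>.\<close>

lemma bfs_tree:
  assumes conn: "\<And>x. x \<in> W \<Longrightarrow> (a, x) \<in> {(x, y). x \<in> W \<and> y \<in> W \<and> {x, y} \<in> E}\<^sup>*"
  obtains d :: "'a \<Rightarrow> nat" and p where
    "\<And>x. x \<in> W \<Longrightarrow> d x = 0 \<Longrightarrow> x = a"
    "\<And>x. x \<in> W \<Longrightarrow> 0 < d x \<Longrightarrow> p x \<in> W \<and> {x, p x} \<in> E \<and> Suc (d (p x)) = d x"
    "\<And>x y. x \<in> W \<Longrightarrow> y \<in> W \<Longrightarrow> {x, y} \<in> E \<Longrightarrow> d y \<le> Suc (d x)"
proof -
  let ?R = "{(x, y). x \<in> W \<and> y \<in> W \<and> {x, y} \<in> E}"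
  define d where "d x = (LEAST n. (a, x) \<in> ?R ^^ n)" for x
  have d: "(a, x) \<in> ?R ^^ d x" if "x \<in> W" for x
    using conn[OF that] unfolding d_def rtrancl_power by (metis (mono_tags, lifting) LeastI_ex)
  have le: "d x \<le> n" if "(a, x) \<in> ?R ^^ n" for x n
    unfolding d_def using that by (rule Least_le)
  have step: "d y \<le> Suc (d x)" if "x \<in> W" "y \<in> W" "{x, y} \<in> E" for x y
    using d[OF that(1)] that by (intro le) auto
  have "\<exists>y. y \<in> W \<and> {x, y} \<in> E \<and> Suc (d y) = d x" if x: "x \<in> W" "0 < d x" for x
  proof -
    obtain m where m: "d x = Suc m" using x by (cases "d x") auto
    with d[OF x(1)] obtain y where y: "(a, y) \<in> ?R ^^ m" "(y, x) \<in> ?R" by auto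
    then have "d y \<le> m" "d x \<le> Suc (d y)" using le step by auto
    then show ?thesis using y m by (intro exI[of _ y]) (auto simp: insert_commute)
  qed
  then obtain p where "\<And>x. x \<in> W \<Longrightarrow> 0 < d x \<Longrightarrow> p x \<in> W \<and> {x, p x} \<in> E \<and> Suc (d (p x)) = d x"
    by metis
  moreover have "x = a" if "x \<in> W" "d x = 0" for x using d[OF that(1)] that(2) by simp
  ultimately show ?thesis using that step by blast
qed

lemma sum_card_fibres_le:
  assumes "finite W" "finite I"
  shows "(\<Sum>i\<in>I. card {x \<in> W. f x = i}) \<le> card W"
proof -
  have "(\<Sum>i\<in>I. card {x \<in> W. f x = i}) = card (\<Union>i\<in>I. {x \<in> W. f x = i})"
    using assms by (subst card_UN_disjoint) auto
  also have "\<dots> \<le> card W" using assms(1) by (intro card_mono) auto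
  finally show ?thesis .
qed

text \<open>Every edge lies inside a level or between consecutive levels. A vertex is counted once
  by its own level and at most twice by the pairs of levels containing it, which accounts for the
  factor 3.\<close>

lemma dense_level:
  fixes d :: "'a \<Rightarrow> nat"
  assumes fin: "finite W" and ne: "W \<noteq> {}" and dense: "3 * K * card W \<le> card (edges_in F W)"
    and simple: "\<And>e. e \<in> F \<Longrightarrow> card e = 2"
    and step: "\<And>x y. x \<in> W \<Longrightarrow> y \<in> W \<Longrightarrow> {x, y} \<in> F \<Longrightarrow> d y \<le> Suc (d x)"
  obtains i U F' where "U \<subseteq> W" "U \<noteq> {}" "F' \<subseteq> F" "K * card U \<le> card (edges_in F' U)"
    "(\<forall>x\<in>U. d x = i) \<or> (\<forall>x\<in>U. d x \<in> {i, Suc i}) \<and> (\<forall>x y. {x, y} \<in> F' \<longrightarrow> d x \<noteq> d y)"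
proof -
  let ?L = "\<lambda>i. {x \<in> W. d x = i}"
  let ?U = "\<lambda>i. ?L i \<union> ?L (Suc i)"
  \<comment> \<open>Edges inside either of the two levels are discarded, so that levels alternate
    along paths in \<open>?F i\<close>.\<close>
  let ?F = "\<lambda>i. {e \<in> F. d ` e = {i, Suc i}}"
  let ?I = "d ` W"
  have finI: "finite ?I" "?I \<noteq> {}" using fin ne by auto
  have "\<exists>i\<in>?I. K * card (?L i) \<le> card (edges_in F (?L i)) \<or>
      K * card (?U i) \<le> card (edges_in (?F i) (?U i))"
  proof (rule ccontr)
    assume "\<not> ?thesis"
    then have lt: "card (edges_in F (?L i)) < K * card (?L i)"
      "card (edges_in (?F i) (?U i)) < K * card (?U i)" if "i \<in> ?I" for i
      using that by (meson not_le)+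
    have "edges_in F W \<subseteq> (\<Union>i\<in>?I. edges_in F (?L i)) \<union> (\<Union>i\<in>?I. edges_in (?F i) (?U i))"
    proof
      fix e assume e: "e \<in> edges_in F W"
      then obtain u v where uv: "e = {u, v}" using simple[of e] by (auto simp: card_2_iff)
      have W: "u \<in> W" "v \<in> W" using e uv by auto
      have "d v \<le> Suc (d u)" "d u \<le> Suc (d v)"
        using step W e uv by (auto simp: insert_commute)
      then consider "d u = d v" | "d v = Suc (d u)" | "d u = Suc (d v)" by linarith
      then show "e \<in> (\<Union>i\<in>?I. edges_in F (?L i)) \<union> (\<Union>i\<in>?I. edges_in (?F i) (?U i))"
      proof cases
        case 1
        then have "e \<in> edges_in F (?L (d u))" using e uv by auto
        then show ?thesis using W by blast
      next
        case 2
        then have "e \<in> edges_in (?F (d u)) (?U (d u))" using e uv by auto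
        then show ?thesis using W by blast
      next
        case 3
        then have "e \<in> edges_in (?F (d v)) (?U (d v))" using e uv by auto
        then show ?thesis using W by blast
      qed
    qed
    then have "card (edges_in F W) \<le>
        card ((\<Union>i\<in>?I. edges_in F (?L i)) \<union> (\<Union>i\<in>?I. edges_in (?F i) (?U i)))"
      using fin by (intro card_mono finite_UnI finite_UN_I finite_edges_in) auto
    also have "\<dots> \<le> (\<Sum>i\<in>?I. card (edges_in F (?L i))) + (\<Sum>i\<in>?I. card (edges_in (?F i) (?U i)))"
      using finI by (intro order.trans[OF card_Un_le] add_mono card_UN_le)
    also have "\<dots> < (\<Sum>i\<in>?I. K * card (?L i)) + (\<Sum>i\<in>?I. K * card (?U i))"
      using finI lt by (intro add_strict_mono sum_strict_mono) auto
    also have "\<dots> \<le> K * (\<Sum>i\<in>?I. card (?L i)) + K * (\<Sum>i\<in>?I. card (?L i) + card (?L (Suc i)))"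
      unfolding sum_distrib_left by (intro add_mono sum_mono mult_le_mono2 card_Un_le) auto
    also have "\<dots> = K * (2 * (\<Sum>i\<in>?I. card (?L i)) + (\<Sum>i\<in>Suc ` ?I. card (?L i)))"
      by (simp add: sum.distrib sum.reindex algebra_simps)
    also have "\<dots> \<le> K * (2 * card W + card W)"
      using finI fin by (intro mult_le_mono2 add_mono sum_card_fibres_le) auto
    finally show False using dense by simp
  qed
  then obtain i where i: "i \<in> ?I" and "K * card (?L i) \<le> card (edges_in F (?L i)) \<or>
      K * card (?U i) \<le> card (edges_in (?F i) (?U i))" by blast
  then consider "K * card (?L i) \<le> card (edges_in F (?L i))"
    | "K * card (?U i) \<le> card (edges_in (?F i) (?U i))" by blast
  then show ?thesis
  proof cases
    case 1
    show ?thesis by (rule that[of "?L i" F i, OF _ _ _ 1]) (use i in auto)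
  next
    case 2
    show ?thesis by (rule that[of "?U i" "?F i" i, OF _ _ _ 2]) (use i in \<open>auto dest: arg_cong[of _ _ card]\<close>)
  qed
qed

text \<open>The deepest common ancestor of \<open>S\<close> lies \<open>j\<close> levels above it,
  and \<open>A\<close> consists of the vertices of \<open>S\<close> below one of its children. Tree
  paths from \<open>A\<close> and from \<open>S - A\<close> first meet at that ancestor.\<close>

lemma tree_branching:
  fixes d :: "'a \<Rightarrow> nat"
  assumes root: "\<And>x. x \<in> W \<Longrightarrow> d x = 0 \<Longrightarrow> x = a"
    and parent: "\<And>x. x \<in> W \<Longrightarrow> 0 < d x \<Longrightarrow> p x \<in> W \<and> {x, p x} \<in> E \<and> Suc (d (p x)) = d x"
    and S: "S \<subseteq> W" "\<And>x. x \<in> S \<Longrightarrow> d x = i" "x0 \<in> S" "y0 \<in> S" "x0 \<noteq> y0"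
  obtains A j where "A \<subseteq> S" "A \<noteq> {}" "A \<noteq> S" "1 \<le> j"
    "\<And>x y. x \<in> A \<Longrightarrow> y \<in> S - A \<Longrightarrow>
      \<exists>q. Suc (length q) = 2 * j \<and> is_path E (y # q @ [x]) \<and> (\<forall>z\<in>set q. d z < i)"
proof -
  have anc: "(p ^^ m) x \<in> W \<and> d ((p ^^ m) x) + m = i" if "x \<in> S" "m \<le> i" for x m
    using that(2)
  proof (induction m)
    case 0
    then show ?case using S that by auto
  next
    case (Suc m)
    then show ?case using parent[of "(p ^^ m) x"] by auto
  qed
  have anc_edge: "{(p ^^ m) x, (p ^^ Suc m) x} \<in> E" if "x \<in> S" "m < i" for x m
    using anc[of x m] parent[of "(p ^^ m) x"] that by auto
  define j where "j = (LEAST j. \<forall>x\<in>S. \<forall>y\<in>S. (p ^^ j) x = (p ^^ j) y)"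
  let ?Q = "\<lambda>j. \<forall>x\<in>S. \<forall>y\<in>S. (p ^^ j) x = (p ^^ j) y"
  \<comment> \<open>The \<open>i\<close>-th ancestor of every vertex on level \<open>i\<close> is
    the root, so the least \<open>j\<close> exists.\<close>
  have "?Q i" using anc[of _ i] root by (metis add_is_0 add_right_cancel add_0 order.refl)
  then have Qj: "?Q j" and ji: "j \<le> i" unfolding j_def by (rule LeastI, rule Least_le)
  have nQ: "\<not> ?Q m" if "m < j" for m using that not_less_Least[of m ?Q] unfolding j_def by blast
  have j1: "1 \<le> j" using Qj S(3-5) by (cases j) auto
  then obtain x1 y1 where xy1: "x1 \<in> S" "y1 \<in> S" "(p ^^ (j - 1)) x1 \<noteq> (p ^^ (j - 1)) y1"
    using nQ[of "j - 1"] by auto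
  define A where "A = {x \<in> S. (p ^^ (j - 1)) x = (p ^^ (j - 1)) x1}"
  have chain: "is_path E (map (\<lambda>m. (p ^^ m) x) [b..<c])" if "x \<in> S" "c \<le> Suc i" for x b c
    unfolding is_path_def
  proof
    have "inj_on (\<lambda>m. (p ^^ m) x) {b..<c}"
    proof (rule inj_onI)
      fix m m' assume "m \<in> {b..<c}" "m' \<in> {b..<c}" "(p ^^ m) x = (p ^^ m') x"
      then show "m = m'" using anc[of x m] anc[of x m'] that by auto
    qed
    then show "distinct (map (\<lambda>m. (p ^^ m) x) [b..<c])" by (simp add: distinct_map)
    show "successively (\<lambda>x y. {x, y} \<in> E) (map (\<lambda>m. (p ^^ m) x) [b..<c])"
      using anc_edge[OF that(1)] that(2) by (auto simp: successively_conv_nth)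
  qed
  have "\<exists>q. Suc (length q) = 2 * j \<and> is_path E (y # q @ [x]) \<and> (\<forall>z\<in>set q. d z < i)"
    if x: "x \<in> A" and y: "y \<in> S - A" for x y
  proof -
    have xS: "x \<in> S" "y \<in> S" using x y by (auto simp: A_def)
    have ne: "(p ^^ (j - 1)) x \<noteq> (p ^^ (j - 1)) y" using x y by (auto simp: A_def)
    let ?c = "\<lambda>x b c. map (\<lambda>m. (p ^^ m) x) [b..<c]"
    \<comment> \<open>Up from \<open>y\<close> through \<open>j\<close> ancestors, the last being
      the common one, then down through \<open>j - 1\<close> ancestors of \<open>x\<close>:
      \<open>2 * j - 1\<close> inner vertices.\<close>
    define q where "q = ?c y 1 (Suc j) @ rev (?c x 1 j)"
    \<comment> \<open>Equal ancestors lie on the same level, so \<open>m = m'\<close>; applying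
      \<open>p\<close> further up would make the ancestors at height \<open>j - 1\<close>
      coincide.\<close>
    have disj: "(p ^^ m) y \<noteq> (p ^^ m') x" if "m \<le> j" "m' < j" for m m'
    proof
      assume eq: "(p ^^ m) y = (p ^^ m') x"
      then have mm: "m = m'" using anc[of y m] anc[of x m'] xS that ji by auto
      have "(p ^^ (j - 1 - m)) ((p ^^ m) z) = (p ^^ (j - 1)) z" for z
        using that mm by (simp flip: funpow_add comp_apply[of "p ^^ _" "p ^^ _"])
      then show False using eq mm ne by metis
    qed
    have "is_path E (?c y 0 (Suc j) @ rev (?c x 0 j))"
    proof (rule is_path_append)
      show "is_path E (rev (?c x 0 j))" using chain[OF xS(1), of j 0] ji by (simp only: is_path_rev)
      show "set (?c y 0 (Suc j)) \<inter> set (rev (?c x 0 j)) = {}"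
        unfolding set_map set_rev set_upt disjoint_iff_not_equal
        by (intro ballI, elim imageE) (simp add: disj)
      have "hd (rev (?c x 0 j)) = (p ^^ (j - 1)) x" using j1 by (simp add: hd_rev last_map)
      moreover have "last (?c y 0 (Suc j)) = (p ^^ j) x"
        using Qj[rule_format, OF xS(2,1)] by simp
      moreover have "{(p ^^ (j - 1)) x, (p ^^ j) x} \<in> E" using anc_edge[OF xS(1), of "j - 1"] j1 ji by simp
      ultimately show "{last (?c y 0 (Suc j)), hd (rev (?c x 0 j))} \<in> E" by (simp only: insert_commute)
    qed (use chain[OF xS(2), of "Suc j" 0] ji in auto)
    moreover have "?c y 0 (Suc j) = y # ?c y 1 (Suc j)" "?c x 0 j = x # ?c x 1 j"
      using j1 by (simp_all add: upt_conv_Cons del: upt_Suc)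
    ultimately have "is_path E (y # q @ [x])"
      by (simp only: q_def append.simps append_assoc rev.simps)
    moreover have "Suc (length q) = 2 * j" using j1 by (simp add: q_def)
    moreover have "d ((p ^^ m) z) < i" if "z \<in> S" "1 \<le> m" "m \<le> j" for z m
      using anc[of z m] that ji by simp
    then have "\<forall>z\<in>set q. d z < i" using xS by (auto simp: q_def simp del: upt_Suc)
    ultimately show ?thesis by blast
  qed
  moreover have "A \<subseteq> S" "x1 \<in> A" "y1 \<in> S - A" using xy1 by (auto simp: A_def)
  then have "A \<subseteq> S" "A \<noteq> {}" "A \<noteq> S" by blast+
  ultimately show ?thesis using that j1 by blast
qed

section \<open>Closing paths up through the tree\<close>

lemma even_period_2: "period h 2 \<Longrightarrow> even (i - j) \<Longrightarrow> h i = h j"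
  using period_mod[of h 2 i] period_mod[of h 2 j] by (metis mod_eq_dvd_iff)

text \<open>The level changes at each step between only two values, and an odd number of vertices
  means an even number of steps.\<close>

lemma path_alternates:
  fixes d :: "'a \<Rightarrow> nat"
  assumes "is_path F p" "\<And>x y. {x, y} \<in> F \<Longrightarrow> d x \<noteq> d y" "\<forall>x\<in>set p. d x \<in> {i, Suc i}"
    and "odd (length p)"
  shows "d (hd p) = d (last p)"
proof -
  have "d (p ! m) = d (hd p) \<longleftrightarrow> even m" if "m < length p" for m
    using that
  proof (induction m)
    case 0
    then show ?case by (simp add: hd_conv_nth)
  next
    case (Suc m)
    have "d (p ! m) \<noteq> d (p ! Suc m)"
      using assms(1,2) Suc.prems by (simp add: is_path_def successively_conv_nth)
    moreover have "d (hd p) \<in> {i, Suc i}" "d (p ! m) \<in> {i, Suc i}" "d (p ! Suc m) \<in> {i, Suc i}"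
      using assms(3) Suc.prems
      by (metis hd_in_set length_greater_0_conv not_less_zero Suc_lessD nth_mem gr_zeroI)+
    ultimately have "d (p ! Suc m) = d (hd p) \<longleftrightarrow> d (p ! m) \<noteq> d (hd p)"
      unfolding insert_iff empty_iff by presburger
    then show ?case using Suc.IH[OF Suc_lessD[OF Suc.prems]] by simp
  qed
  from this[of "length p - 1"] assms(4) show ?thesis by (cases p) (auto simp: last_conv_nth)
qed

text \<open>A path of length \<open>t\<close> in \<open>F\<close> between \<open>A\<close> and
  \<open>S - A\<close> closes up through the tree to a cycle of length \<open>t + 2 * j\<close>. On
  a single level at least all odd \<open>t\<close> are available; between two levels, all even
  \<open>t\<close>.\<close>

lemma cycle_lengths_from_level:
  fixes f :: "int \<Rightarrow> 'a" and n r :: int and d :: "'a \<Rightarrow> nat"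
  assumes root: "\<And>x. x \<in> W \<Longrightarrow> d x = 0 \<Longrightarrow> x = a"
    and parent: "\<And>x. x \<in> W \<Longrightarrow> 0 < d x \<Longrightarrow> p x \<in> W \<and> {x, p x} \<in> E \<and> Suc (d (p x)) = d x"
    and FE: "F \<subseteq> E" and fW: "range f \<subseteq> W"
    and f_eq: "\<And>i j. f i = f j \<longleftrightarrow> i mod n = j mod n"
    and edge: "\<And>i. {f i, f (i + 1)} \<in> F" and chord: "{f 0, f r} \<in> F"
    and r: "2 \<le> r" "r + 2 \<le> n"
    and lev: "(\<forall>x\<in>range f. d x = i) \<or>
      (\<forall>x\<in>range f. d x \<in> {i, Suc i}) \<and> (\<forall>x y. {x, y} \<in> F \<longrightarrow> d x \<noteq> d y)"
  obtains j where "1 \<le> j"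
    "(\<forall>t. 0 < t \<and> int t < n \<and> even t \<longrightarrow> has_cycle_of_length E (t + 2 * j)) \<or>
     (\<forall>t. 0 < t \<and> int t < n \<and> odd t \<longrightarrow> has_cycle_of_length E (t + 2 * j))"
proof -
  define S where "S = {x \<in> range f. d x = i}"
  define q where "q = (\<lambda>m. d (f m) = i)"
  have alt: "q (m + 1) \<longleftrightarrow> \<not> q m" if "\<not> (\<forall>x\<in>range f. d x = i)" for m
  proof -
    have "d (f m) \<noteq> d (f (m + 1))" "d (f m) \<in> {i, Suc i}" "d (f (m + 1)) \<in> {i, Suc i}"
      using lev that edge[of m] by blast+
    then show ?thesis by (auto simp: q_def)
  qed
  have pq: "period q 2"
  proof (cases "\<forall>x\<in>range f. d x = i")
    case False
    show ?thesis unfolding period_def using alt[OF False] by (metis add.assoc one_add_one)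
  qed (auto simp: period_def q_def)
  \<comment> \<open>Positions \<open>m\<close> and \<open>m + 2\<close> are both on level
    \<open>i\<close>, and \<open>n \<ge> 4\<close> makes their vertices distinct, so
    \<open>S\<close> has the two elements needed for branching.\<close>
  obtain m where m: "q m" using alt[of 0] by (cases "\<forall>x\<in>range f. d x = i") (auto simp: q_def)
  then have "q (m + 2)" using pq by (simp add: period_def)
  then have S2: "f m \<in> S" "f (m + 2) \<in> S" using m by (auto simp: S_def q_def)
  have ne: "f m \<noteq> f (m + 2)"
    using periodic_window_inj[of m n "m + 2"] r by (auto simp: f_eq)
  have SW: "S \<subseteq> W" "\<And>x. x \<in> S \<Longrightarrow> d x = i" using fW by (auto simp: S_def)
  obtain A j where A: "A \<subseteq> S" "A \<noteq> {}" "A \<noteq> S" and j: "1 \<le> j"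
    and branch: "\<And>x y. x \<in> A \<Longrightarrow> y \<in> S - A \<Longrightarrow>
      \<exists>q. Suc (length q) = 2 * j \<and> is_path E (y # q @ [x]) \<and> (\<forall>z\<in>set q. d z < i)"
    by (rule tree_branching[OF root parent SW S2 ne]) (assumption | (rule that; assumption))+
  have ge: "i \<le> d x" if "x \<in> range f" for x using lev that by auto
  \<comment> \<open>The tree path \<open>v\<close> stays strictly above level \<open>i\<close>,
    while \<open>u\<close> stays on level \<open>i\<close> or below, so they are disjoint.\<close>
  have close1: "has_cycle_of_length E (length u - 1 + 2 * j)"
    if u: "is_path F u" "set u \<subseteq> range f" "hd u \<in> A" "last u \<in> S - A" "length u \<ge> 2" for u
  proof -
    obtain v where v: "Suc (length v) = 2 * j" "is_path E (last u # v @ [hd u])" "\<forall>z\<in>set v. d z < i"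
      using branch[OF u(3,4)] by blast
    have vne: "v \<noteq> []" and une: "u \<noteq> []" using v(1) u(5) by (cases j; auto)+
    have "is_path E ([last u] @ v)" "is_path E (v @ [hd u])"
      using is_path_appendD[of E "last u # v" "[hd u]"] is_path_appendD[of E "[last u]" "v @ [hd u]"] v(2)
      by auto
    then have vp: "is_path E v" "{last u, hd v} \<in> E" "{last v, hd u} \<in> E"
      using vne by (auto simp: is_path_def successively_append_iff successively_Cons)
    have "is_path E (u @ v)"
      using is_path_mono[OF u(1) FE] vp u(2) v(3) ge by (intro is_path_append) fastforce+
    moreover have "3 \<le> length (u @ v)" unfolding length_append using v(1) j u(5) by linarith
    ultimately have "is_cycle E (u @ v)"
      using vp vne une by (intro is_cycle_of_path) auto
    moreover have "length (u @ v) = length u - 1 + 2 * j" using v(1) u(5) by simp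
    ultimately show ?thesis unfolding has_cycle_of_length_def by blast
  qed
  have close2: "has_cycle_of_length E (length u - 1 + 2 * j)"
    if u: "is_path F u" "set u \<subseteq> range f" "(hd u \<in> A) \<noteq> (last u \<in> A)" "length u \<ge> 2"
      "hd u \<in> S" "last u \<in> S" for u
  proof (cases "hd u \<in> A")
    case True
    then show ?thesis using close1[of u] u by blast
  next
    case False
    then show ?thesis using close1[of "rev u"] u by (auto simp: hd_rev last_rev)
  qed
  have path: "\<exists>u. is_path F u \<and> set u \<subseteq> range f \<and> length u = t + 1 \<and> (hd u \<in> A) \<noteq> (last u \<in> A)"
    if "\<not> period (\<lambda>m. f m \<in> A) 2" "0 < t" "int t < n" for t
    using chorded_cycle_paths[OF f_eq edge chord r, of "int t" "\<lambda>x. x \<in> A"] that by force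
  show ?thesis
  proof (cases "\<forall>x\<in>range f. d x = i")
    case True
    then have S: "S = range f" by (auto simp: S_def)
    have inS: "hd u \<in> S \<and> last u \<in> S" if "set u \<subseteq> range f" "length u \<ge> 2" for u
      unfolding S using that hd_in_set[of u] last_in_set[of u] by fastforce
    show ?thesis
    proof (cases "period (\<lambda>m. f m \<in> A) 2")
      case per: True
      have "has_cycle_of_length E (t + 2 * j)" if t: "0 < t" "int t < n" "odd t" for t
      proof -
        let ?u = "map f [0..int t]"
        \<comment> \<open>Positions 0 and \<open>t\<close> have different parity; if they agreed
          about \<open>A\<close>, the period 2 would make all of \<open>S\<close> agree.\<close>
        have "f 0 \<in> A \<longleftrightarrow> f (int t) \<notin> A"
        proof (rule ccontr)
          assume *: "\<not> ?thesis"
          have "f m \<in> A \<longleftrightarrow> f 0 \<in> A" for m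
            using even_period_2[OF per, of m 0] even_period_2[OF per, of m "int t"] * t(3) by auto
          with A S show False by blast
        qed
        moreover have "is_path F ?u" by (rule is_path_arc[OF f_eq edge]) (use t in auto)
        moreover have "hd ?u = f 0" "last ?u = f (int t)" by (simp_all add: hd_conv_nth last_conv_nth)
        moreover have "length ?u = t + 1" "set ?u \<subseteq> range f" by auto
        ultimately show ?thesis using close2[of ?u] inS[of ?u] t by simp
      qed
      with that j show ?thesis by blast
    next
      case False
      have "has_cycle_of_length E (t + 2 * j)" if t: "0 < t" "int t < n" for t
        using path[OF False t] close2 inS t(1) by fastforce
      with that j show ?thesis by blast
    qed
  next
    case False
    then have lv: "\<forall>x\<in>range f. d x \<in> {i, Suc i}" "\<And>x y. {x, y} \<in> F \<Longrightarrow> d x \<noteq> d y"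
      using lev by blast+
    \<comment> \<open>Level \<open>i\<close> occupies just one parity class of positions, so with
      period 2 the set \<open>A\<close> would contain all of \<open>S\<close> or nothing.\<close>
    have "\<not> period (\<lambda>m. f m \<in> A) 2"
    proof
      assume per: "period (\<lambda>m. f m \<in> A) 2"
      obtain x y where xy: "x \<in> A" "y \<in> S - A" using A by blast
      then obtain b c where "x = f b" "y = f c" using A(1) unfolding S_def by blast
      with xy have bc: "f b \<in> A" "f c \<in> S - A" by auto
      then have "q b" "q c" using A(1) by (auto simp: S_def q_def)
      moreover have "q (c + 1) \<longleftrightarrow> \<not> q c" using alt[OF False] .
      ultimately have "even (b - c)"
        using even_period_2[OF pq, of b "c + 1"] by (auto simp: diff_diff_eq[symmetric])
      with even_period_2[OF per, of b c] bc show False by auto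
    qed
    note path = path[OF this]
    have "has_cycle_of_length E (t + 2 * j)" if t: "0 < t" "int t < n" "even t" for t
    proof -
      obtain u where u: "is_path F u" "set u \<subseteq> range f" "length u = t + 1" "(hd u \<in> A) \<noteq> (last u \<in> A)"
        using path t by blast
      \<comment> \<open>Even length puts both ends on one level, and the end in \<open>A\<close>
        shows that it is level \<open>i\<close>; hence both ends are in \<open>S\<close>.\<close>
      have "d (hd u) = d (last u)"
        by (rule path_alternates[OF u(1) lv(2)]) (use u t lv(1) in auto)
      moreover have "u \<noteq> []" using u(3) by auto
      then have "hd u \<in> range f" "last u \<in> range f" using u(2) by auto
      ultimately have "hd u \<in> S" "last u \<in> S" using u(4) A(1) by (auto simp: S_def)
      with close2[OF u(1,2,4)] u(3) t(1) show ?thesis by simp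
    qed
    with that j show ?thesis by blast
  qed
qed

section \<open>From the average degree to the cycle lengths\<close>

theorem theorem5:
  fixes V :: "'a set" and E :: "'a set set" and k g :: nat
  assumes "k \<ge> 2"
    and "finite_graph V E"
    and "average_degree V E \<ge> 6 * real k"
    and "girth E = enat g"
  shows "\<exists>r::nat. odd r \<and> r \<ge> 3 \<and>
    ((\<forall>n\<in>{r..r + (g - 2) * k}. even n \<longrightarrow> has_cycle_of_length E n) \<or>
     (\<forall>n\<in>{r..r + (g - 2) * k}. odd n \<longrightarrow> has_cycle_of_length E n))"
proof -
  have finV: "finite V" and simple: "\<And>e. e \<in> E \<Longrightarrow> card e = 2" and "E \<subseteq> Pow V"
    using assms(2) by (auto simp: finite_graph_def)
  then have EV: "edges_in E V = E" by auto
  have V: "V \<noteq> {}" using assms(1,3) by (auto simp: average_degree_def)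
  then have "0 < card V" using finV by auto
  then have "6 * real k * real (card V) \<le> 2 * real (card E)"
    using assms(3) by (simp add: average_degree_def field_simps)
  then have "real (3 * k * card V) \<le> real (card E)" by simp
  then have "3 * k * card V \<le> card (edges_in E V)" unfolding EV of_nat_le_iff .
  \<comment> \<open>The minimal dense set \<open>W\<close>, connected by minimality, takes the place
    of a component.\<close>
  from minimal_dense_subset[OF V this finV] obtain W where W: "W \<subseteq> V" "W \<noteq> {}"
    "3 * k * card W \<le> card (edges_in E W)"
    "\<And>W'. W' \<subset> W \<Longrightarrow> W' \<noteq> {} \<Longrightarrow> card (edges_in E W') < 3 * k * card W'"
    by blast
  have finW: "finite W" using W(1) finV finite_subset by blast
  obtain a where a: "a \<in> W" using W(2) by blast
  note conn = minimal_dense_connected[OF finW a W(3,4) simple]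
  obtain d :: "'a \<Rightarrow> nat" and p where root: "\<And>x. x \<in> W \<Longrightarrow> d x = 0 \<Longrightarrow> x = a"
    and parent: "\<And>x. x \<in> W \<Longrightarrow> 0 < d x \<Longrightarrow> p x \<in> W \<and> {x, p x} \<in> E \<and> Suc (d (p x)) = d x"
    and step: "\<And>x y. x \<in> W \<Longrightarrow> y \<in> W \<Longrightarrow> {x, y} \<in> E \<Longrightarrow> d y \<le> Suc (d x)"
    using bfs_tree[OF conn] by blast
  obtain i U F where U: "U \<subseteq> W" "U \<noteq> {}" and F: "F \<subseteq> E" and dense: "k * card U \<le> card (edges_in F U)"
    and lev: "(\<forall>x\<in>U. d x = i) \<or> (\<forall>x\<in>U. d x \<in> {i, Suc i}) \<and> (\<forall>x y. {x, y} \<in> F \<longrightarrow> d x \<noteq> d y)"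
    by (rule dense_level[where d = d, OF finW W(2,3) simple step]) (assumption | (rule that; assumption))+
  have simpleF: "\<And>e. e \<in> F \<Longrightarrow> card e = 2" using F simple by blast
  have finU: "finite U" using U(1) finW finite_subset by blast
  obtain U' where U': "U' \<subseteq> U" "U' \<noteq> {}" "\<And>v. v \<in> U' \<Longrightarrow> Suc k \<le> card {u \<in> U'. {v, u} \<in> F}"
    by (rule dense_subset_min_degree[OF finU U(2) dense _ simpleF])
      (use assms(1) in linarith | assumption | (rule that; assumption))+
  have girth: "g \<le> m" if "has_cycle_of_length F m" for m
  proof -
    have "has_cycle_of_length E m" using that F unfolding has_cycle_of_length_def is_cycle_def by blast
    then have "girth E \<le> enat m" unfolding girth_def by (intro Inf_lower) auto
    then show ?thesis using assms(4) by simp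
  qed
  have loopless: "{v, v} \<notin> F" for v using simpleF[of "{v, v}"] by auto
  obtain xs r where xs: "is_path F xs" "set xs \<subseteq> U'" "(g - 2) * k + 2 \<le> length xs"
    "{hd xs, last xs} \<in> F" "{hd xs, xs ! r} \<in> F" "2 \<le> r" "r + 2 \<le> length xs"
    by (rule long_cycle_with_chord[OF finite_subset[OF U'(1) finU] U'(2) assms(1) U'(3) loopless girth])
      (assumption | (rule that; assumption))+
  define n where "n = int (length xs)"
  \<comment> \<open>The cyclic list is unrolled to an \<open>n\<close>-periodic map on the integers;
    the edge from the last vertex back to the first appears where
    \<open>i mod n = n - 1\<close>.\<close>
  define f where "f i = xs ! nat (i mod n)" for i
  have n: "0 < n" using xs(7) unfolding n_def by linarith
  have lt: "nat (i mod n) < length xs" for i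
    using pos_mod_bound[OF n, of i] nat_less_iff[OF pos_mod_sign[OF n], of i] by (simp add: n_def)
  have f_eq: "f i = f j \<longleftrightarrow> i mod n = j mod n" for i j
    using xs(1) lt n by (simp add: f_def is_path_def nth_eq_iff_index_eq eq_nat_nat_iff)
  have rf: "range f \<subseteq> U'" using xs(2) lt nth_mem by (fastforce simp: f_def)
  have "xs \<noteq> []" using xs(7) by auto
  then have ends: "hd xs = xs ! 0" "last xs = xs ! (length xs - 1)"
    by (simp_all add: hd_conv_nth last_conv_nth)
  have step_mod: "(i + 1) mod n = (i mod n + 1) mod n" for i
    by (rule mod_add_left_eq[symmetric])
  have edge: "{f i, f (i + 1)} \<in> F" for i
  proof (cases "i mod n = n - 1")
    case True
    then have "(i + 1) mod n = 0" unfolding step_mod[of i] by simp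
    moreover have "nat (n - 1) = length xs - 1" unfolding n_def by linarith
    ultimately show ?thesis using True xs(4) ends by (simp add: f_def insert_commute)
  next
    case False
    then have "i mod n + 1 < n" using pos_mod_bound[OF n, of i] by linarith
    then have "(i + 1) mod n = i mod n + 1"
      unfolding step_mod[of i] using pos_mod_sign[OF n, of i] by (intro mod_pos_pos_trivial) auto
    then have "nat ((i + 1) mod n) = Suc (nat (i mod n))"
      using pos_mod_sign[OF n, of i] by (simp only: Suc_nat_eq_nat_zadd1 add.commute)
    then show ?thesis
      using xs(1) lt[of "i + 1"] by (simp add: f_def is_path_def successively_conv_nth)
  qed
  have "int r mod n = int r" using xs(7) by (intro mod_pos_pos_trivial) (auto simp: n_def)
  then have chord: "{f 0, f (int r)} \<in> F" using xs(5) ends by (simp add: f_def)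
  have bounds: "2 \<le> int r" "int r + 2 \<le> n" using xs(6,7) by (auto simp: n_def)
  have rU: "range f \<subseteq> U" using rf U'(1) by blast
  obtain j where j: "1 \<le> j"
    and cyc: "(\<forall>t. 0 < t \<and> int t < n \<and> even t \<longrightarrow> has_cycle_of_length E (t + 2 * j)) \<or>
     (\<forall>t. 0 < t \<and> int t < n \<and> odd t \<longrightarrow> has_cycle_of_length E (t + 2 * j))"
    by (rule cycle_lengths_from_level[OF root parent F _ f_eq edge chord bounds, of i]) (use rU U(1) lev in blast)+
  \<comment> \<open>Subtracting \<open>2 * j\<close> preserves parity and leaves \<open>t\<close>
    between 1 and \<open>(g - 2) * k + 1\<close>, which is below \<open>n\<close>. As
    \<open>j \<ge> 1\<close>, the left end \<open>2 * j + 1\<close> is odd and at least 3.\<close>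
  have shift: "\<exists>t. m = t + 2 * j \<and> 0 < t \<and> int t < n \<and> (even t \<longleftrightarrow> even m)"
    if "m \<in> {2 * j + 1..2 * j + 1 + (g - 2) * k}" for m
    using that xs(3) by (intro exI[of _ "m - 2 * j"]) (auto simp: n_def)
  show ?thesis
  proof (intro exI[of _ "2 * j + 1"] conjI)
    from cyc shift show "(\<forall>n\<in>{2 * j + 1..2 * j + 1 + (g - 2) * k}. even n \<longrightarrow> has_cycle_of_length E n) \<or>
     (\<forall>n\<in>{2 * j + 1..2 * j + 1 + (g - 2) * k}. odd n \<longrightarrow> has_cycle_of_length E n)"
      by metis
  qed (use j in auto)
qed

end
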